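(* If $\mathbf A$ is a De Morgan algebra, then the algebra $\mathbf A^{\circ}$ (defined in the context by adding a new bottom $\hat{\mathbf f}$, a new top $\hat{\mathbf t}$ and a perfection operator $\circ$ to $\mathbf A$) is a perfect paradefinite algebra (PP-algebra).
   Context: A De Morgan algebra is a bounded distributive lattice $\langle A;\land,\lor,\top,\bot\rangle$ with a unary operation $\sim$ satisfying ${\sim}{\sim}x\approx x$ and ${\sim}(x\land y)\approx{\sim}x\lor{\sim}y$. A perfect paradefinite algebra (PP-algebra) is a De Morgan algebra with an additional unary operation $\circ$ satisfying: (PP1) $\circ\circ x\approx\top$; (PP2) $\circ x\approx\circ{\sim}x$; (PP3) $\circ\top\approx\top$; (PP4) $x\land{\sim}x\land\circ x\approx\bot$; (PP5) $\circ(x\land y)\approx(\circ x\lor\circ y)\land(\circ x\lor{\sim}y)\land(\circ y\lor{\sim}x)$. Given an algebra $\mathbf A$ over $\{\land,\lor,\sim,\top,\bot\}$ and two distinct elements $\hat{\mathbf f},\hat{\mathbf t}\notin A$, the algebra $\mathbf A^{\circ}$ has carrier $A\cup\{\hat{\mathbf f},\hat{\mathbf t}\}$ and operations as follows. $a\land b$ is $a\land^{\mathbf A}b$ if $a,b\in A$; $\hat{\mathbf f}$ if $a=\hat{\mathbf f}$ or $b=\hat{\mathbf f}$; $\hat{\mathbf t}$ if $a=b=\hat{\mathbf t}$; and $c$ if $\{a,b\}=\{\hat{\mathbf t},c\}$ with $c\in A$. Dually, $a\lor b$ is $a\lor^{\mathbf A}b$ if $a,b\in A$; $\hat{\mathbf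 t}$ if $a=\hat{\mathbf t}$ or $b=\hat{\mathbf t}$; $\hat{\mathbf f}$ if $a=b=\hat{\mathbf f}$; and $c$ if $\{a,b\}=\{\hat{\mathbf f},c\}$ with $c\in A$. ${\sim}a={\sim}^{\mathbf A}a$ for $a\in A$, ${\sim}\hat{\mathbf t}=\hat{\mathbf f}$, ${\sim}\hat{\mathbf f}=\hat{\mathbf t}$. $\circ a=\hat{\mathbf t}$ if $a\in\{\hat{\mathbf f},\hat{\mathbf t}\}$ and $\circ a=\hat{\mathbf f}$ if $a\in A$. $\bot=\hat{\mathbf f}$ and $\top=\hat{\mathbf t}$. *)

theory Defs
  imports "HOL-Algebra.Congruence"
begin

text \<open>
  Algebras are records with an explicit carrier. The operations are HOL functions on the whole
  type; only their values on the carrier are constrained.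
\<close>

record 'a dm_signature = "'a partial_object" +
  meet :: "'a \<Rightarrow> 'a \<Rightarrow> 'a"  (infixl "\<sqinter>\<index>" 70)
  join :: "'a \<Rightarrow> 'a \<Rightarrow> 'a"  (infixl "\<squnion>\<index>" 65)
  dneg :: "'a \<Rightarrow> 'a"  ("\<sim>\<index> _" [81] 80)
  topp :: 'a  ("\<top>\<index>")
  bott :: 'a  ("\<bottom>\<index>")

record 'a pp_signature = "'a dm_signature" +
  perf :: "'a \<Rightarrow> 'a"  ("\<^bold>\<circ>\<index> _" [81] 80)

locale bounded_distributive_lattice =
  fixes A (structure)
  assumes meet_closed [intro, simp]:
      "\<lbrakk>x \<in> carrier A; y \<in> carrier A\<rbrakk> \<Longrightarrow> x \<sqinter> y \<in> carrier A"
    and join_closed [intro, simp]: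
      "\<lbrakk>x \<in> carrier A; y \<in> carrier A\<rbrakk> \<Longrightarrow> x \<squnion> y \<in> carrier A"
    and top_closed [intro, simp]: "\<top> \<in> carrier A"
    and bot_closed [intro, simp]: "\<bottom> \<in> carrier A"
    and meet_assoc: "\<lbrakk>x \<in> carrier A; y \<in> carrier A; z \<in> carrier A\<rbrakk>
      \<Longrightarrow> (x \<sqinter> y) \<sqinter> z = x \<sqinter> (y \<sqinter> z)"
    and join_assoc: "\<lbrakk>x \<in> carrier A; y \<in> carrier A; z \<in> carrier A\<rbrakk>
      \<Longrightarrow> (x \<squnion> y) \<squnion> z = x \<squnion> (y \<squnion> z)"
    and meet_comm: "\<lbrakk>x \<in> carrier A; y \<in> carrier A\<rbrakk> \<Longrightarrow> x \<sqinter> y = y \<sqinter> x"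
    and join_comm: "\<lbrakk>x \<in> carrier A; y \<in> carrier A\<rbrakk> \<Longrightarrow> x \<squnion> y = y \<squnion> x"
    and meet_join_absorb: "\<lbrakk>x \<in> carrier A; y \<in> carrier A\<rbrakk> \<Longrightarrow> x \<sqinter> (x \<squnion> y) = x"
    and join_meet_absorb: "\<lbrakk>x \<in> carrier A; y \<in> carrier A\<rbrakk> \<Longrightarrow> x \<squnion> (x \<sqinter> y) = x"
    and meet_join_distrib: "\<lbrakk>x \<in> carrier A; y \<in> carrier A; z \<in> carrier A\<rbrakk>
      \<Longrightarrow> x \<sqinter> (y \<squnion> z) = (x \<sqinter> y) \<squnion> (x \<sqinter> z)"
    and meet_top: "x \<in> carrier A \<Longrightarrow> x \<sqinter> \<top> = x"
    and join_bot: "x \<in> carrier A \<Longrightarrow> x \<squnion> \<bottom> = x"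

locale de_morgan_algebra = bounded_distributive_lattice +
  assumes dneg_closed [intro, simp]: "x \<in> carrier A \<Longrightarrow> \<sim> x \<in> carrier A"
    and dneg_dneg: "x \<in> carrier A \<Longrightarrow> \<sim> (\<sim> x) = x"
    and dneg_meet: "\<lbrakk>x \<in> carrier A; y \<in> carrier A\<rbrakk> \<Longrightarrow> \<sim> (x \<sqinter> y) = \<sim> x \<squnion> \<sim> y"

locale pp_algebra = de_morgan_algebra +
  assumes perf_closed [intro, simp]: "x \<in> carrier A \<Longrightarrow> \<^bold>\<circ> x \<in> carrier A"
    and PP1: "x \<in> carrier A \<Longrightarrow> \<^bold>\<circ> (\<^bold>\<circ> x) = \<top>"
    and PP2: "x \<in> carrier A \<Longrightarrow> \<^bold>\<circ> x = \<^bold>\<circ> (\<sim> x)"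
    and PP3: "\<^bold>\<circ> \<top> = \<top>"
    and PP4: "x \<in> carrier A \<Longrightarrow> x \<sqinter> \<sim> x \<sqinter> \<^bold>\<circ> x = \<bottom>"
    and PP5: "\<lbrakk>x \<in> carrier A; y \<in> carrier A\<rbrakk> \<Longrightarrow>
      \<^bold>\<circ> (x \<sqinter> y) = (\<^bold>\<circ> x \<squnion> \<^bold>\<circ> y) \<sqinter> (\<^bold>\<circ> x \<squnion> \<sim> y) \<sqinter> (\<^bold>\<circ> y \<squnion> \<sim> x)"

text \<open>
  The extension of \<open>A\<close> by a new bottom \<open>f\<close> and a new top \<open>t\<close>. It is meaningful only for distinct
  \<open>f\<close> and \<open>t\<close> outside the carrier of \<open>A\<close>, so statements about it must assume this; the case
  distinctions below are then exhaustive and unambiguous on the new carrier. In the last two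
  branches of \<open>meet\<close>, one argument is \<open>t\<close> and the other one lies in \<open>A\<close>; dually for \<open>join\<close>.
\<close>

definition perf_ext :: "('a, 'm) dm_signature_scheme \<Rightarrow> 'a \<Rightarrow> 'a \<Rightarrow> 'a pp_signature" where
  "perf_ext A f t =
    \<lparr>carrier = carrier A \<union> {f, t},
     meet = (\<lambda>a b. if a \<in> carrier A \<and> b \<in> carrier A then a \<sqinter>\<^bsub>A\<^esub> b
                   else if a = f \<or> b = f then f
                   else if a = t \<and> b = t then t
                   else if a = t then b
                   else a),
     join = (\<lambda>a b. if a \<in> carrier A \<and> b \<in> carrier A then a \<squnion>\<^bsub>A\<^esub> b
                   else if a = t \<or> b = t then t
                   else if a = f \<and> b = f then f
                   else if a = f then b
                   else a),
     dneg = (\<lambda>a. if a \<in> carrier A then \<sim>\<^bsub>A\<^esub> a else if a = t then f else t),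
     topp = t,
     bott = f,
     perf = (\<lambda>a. if a \<in> {f, t} then t else f)\<rparr>"

end

theory Submission
  imports Defs
begin

text \<open>
  Ordering the new carrier by placing \<open>f\<close> strictly below and \<open>t\<close> strictly above all of \<open>A\<close> gives a
  bounded lattice, whose meets and joins are those of \<open>A\<close> except that \<open>f\<close> and \<open>t\<close> act as the
  bounds. An instance of an axiom of De Morgan algebras that involves \<open>f\<close> or \<open>t\<close> collapses, once these act as
  zero or unit, to a trivial identity or to idempotence or absorption in \<open>A\<close>. The old bounds of
  \<open>A\<close> are ordinary elements of the extension, and the new negation reverses the extended order
  because it swaps the two new elements.

  As to perfection, the value of \<open>\<^bold>\<circ>\<close> only tells whether the argument is one of the two new
  elements, and it is itself always one of them. With \<open>\<sim>\<close> preserving both \<open>{f, t}\<close> and the carrier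
  of \<open>A\<close>, this gives the first three axioms. In the fourth, either \<open>\<^bold>\<circ> x = f\<close> or
  \<open>{x, \<sim> x} = {f, t}\<close>. The fifth expresses when a meet is new: it is new iff both arguments are
  new or one of them is \<open>f\<close>, and the right-hand side takes the value \<open>t\<close> exactly then and \<open>f\<close>
  otherwise.
\<close>

context bounded_distributive_lattice
begin

lemma meet_idem: "x \<in> carrier A \<Longrightarrow> x \<sqinter> x = x"
  by (metis join_bot bot_closed meet_join_absorb)

lemma join_idem: "x \<in> carrier A \<Longrightarrow> x \<squnion> x = x"
  by (metis meet_top top_closed join_meet_absorb)

text \<open>
  The distributive law \<open>x \<sqinter> (y \<squnion> z) = (x \<sqinter> y) \<squnion> (x \<sqinter> z)\<close> with \<open>z\<close> replaced by a top element reduces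
  to this form of absorption; replacing \<open>y\<close> instead gives the axiom \<open>join_meet_absorb\<close>.
\<close>

lemma meet_join_absorb_left:
  "\<lbrakk>x \<in> carrier A; y \<in> carrier A\<rbrakk> \<Longrightarrow> (x \<sqinter> y) \<squnion> x = x"
  by (metis join_comm join_meet_absorb meet_closed)

end

lemma bounded_distributive_lattice_perf_ext:
  assumes "bounded_distributive_lattice A"
    and "f \<notin> carrier A" and "t \<notin> carrier A" and "f \<noteq> t"
  shows "bounded_distributive_lattice (perf_ext A f t)"
proof -
  interpret bounded_distributive_lattice A by fact
  note new = assms(2-4) assms(4)[symmetric]
  show ?thesis
    by unfold_locales
      (use new in \<open>auto simp: perf_ext_def meet_assoc join_assoc
        meet_join_absorb join_meet_absorb meet_join_distrib meet_idem join_idem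
        meet_join_absorb_left intro: meet_comm join_comm\<close>)
qed

lemma de_morgan_algebra_perf_ext:
  assumes "de_morgan_algebra A"
    and "f \<notin> carrier A" and "t \<notin> carrier A" and "f \<noteq> t"
  shows "de_morgan_algebra (perf_ext A f t)"
proof -
  interpret de_morgan_algebra A by fact
  interpret ext: bounded_distributive_lattice "perf_ext A f t"
    using bounded_distributive_lattice_axioms assms(2-4)
    by (rule bounded_distributive_lattice_perf_ext)
  note new = assms(2-4) assms(4)[symmetric]
  show ?thesis
    by unfold_locales (use new in \<open>auto simp: perf_ext_def dneg_dneg dneg_meet\<close>)
qed

theorem proposition3p16:
  fixes A :: "'a dm_signature" and f t :: 'a
  assumes "de_morgan_algebra A"
    and "f \<notin> carrier A" and "t \<notin> carrier A" and "f \<noteq> t"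
  shows "pp_algebra (perf_ext A f t)"
proof -
  interpret de_morgan_algebra A by fact
  interpret ext: de_morgan_algebra "perf_ext A f t"
    using assms by (rule de_morgan_algebra_perf_ext)
  note new = assms(2-4) assms(4)[symmetric]
  \<comment> \<open>Closure rules out that an operation of \<open>A\<close> yields a new element.\<close>
  have old: "\<lbrakk>x \<in> carrier A; y \<in> carrier A\<rbrakk> \<Longrightarrow> x \<sqinter>\<^bsub>A\<^esub> y \<noteq> f \<and> x \<sqinter>\<^bsub>A\<^esub> y \<noteq> t"
    "x \<in> carrier A \<Longrightarrow> \<sim>\<^bsub>A\<^esub> x \<noteq> f \<and> \<sim>\<^bsub>A\<^esub> x \<noteq> t" for x y
    using new by (metis meet_closed, metis dneg_closed)
  show ?thesis
    by unfold_locales (use new old in \<open>auto simp: perf_ext_def\<close>)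
qed

end
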